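(* Let $\mathfrak T$ be a measurable action of an inductively compact group $G$ on a standard Borel space $(X,\mathcal B)$, and let $\rho$ be a positive measurable multiplicative cocycle over $\mathfrak T$. If a measure $\nu\in\mathfrak M(\mathfrak T,\rho)$ is ergodic, then $\nu$ is indecomposable in $\mathfrak M(\mathfrak T,\rho)$.
   Context: A standard Borel space is a pair $(X,\mathcal B)$, $\mathcal B$ a sigma-algebra on $X$, admitting a bijection of $X$ onto the unit interval carrying $\mathcal B$ to the Borel sigma-algebra. An inductively compact group is $G=\bigcup_{n\ge1}K(n)$, where $K(1)\subset K(2)\subset\cdots$ is an ascending chain of metrizable compact groups; $G$ carries the inductive limit topology and the Borel sigma-algebra spanned by the Borel sigma-algebras of the $K(n)$. A measurable action $\mathfrak T$ of $G$ on $X$ is an action $g\mapsto T_g$ for which $(g,x)\mapsto T_gx$, $G\times X\to X$, is Borel-measurable. A positive measurable multiplicative cocycle over $\mathfrak T$ is a measurable map $\rho:G\times X\to\mathbb R_{>0}$ with $\rho(gh,x)=\rho(g,T_hx)\rho(h,x)$. With $\nu\circ T_g(A)=\nu(T_gA)$, $\mathfrak M(\mathfrak T,\rho)$ is the set of Borel probability measures $\nu$ on $X$ such that for all $g\in G$, $\frac{d\nu\circ T_g}{d\nu}(x)=\rho(g,x)$ for $\nu$-almost all $x$. A measure $\nu\in\mathfrak M(\mathfrak T,\rho)$ is ergodic if every $G$-invariant Borel set $A$ has $\nu(A)=0$ or $\nu(X\setminus A)=0$. It is indecomposable in $\mathfrak M(\mathfrak T,\rho)$ if $\nu=\alpha\nu_1+(1-\alpha)\nu_2$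 with $\alpha\in(0,1)$, $\nu_1,\nu_2\in\mathfrak M(\mathfrak T,\rho)$ implies $\nu=\nu_1=\nu_2$. *)

theory Defs
  imports "HOL-Probability.Probability" "HOL-Algebra.Group_Action"
begin

text \<open>
  Measurable spaces are given by the \<open>space\<close> and \<open>sets\<close> of a value of type \<open>'x measure\<close>; its measure
  component is irrelevant.
\<close>

definition standard_borel_space :: "'x measure \<Rightarrow> bool" where
  "standard_borel_space X \<longleftrightarrow>
    (\<exists>f :: 'x \<Rightarrow> real. bij_betw f (space X) {0..1} \<and>
       (\<lambda>A. f ` A) ` sets X = sets (restrict_space borel {0..1}))"

text \<open>
  Each \<open>K n\<close> is a topology whose \<open>topspace\<close> is the \<open>n\<close>-th compact group of the chain, with the operations
  inherited from \<open>G\<close>. The chain is indexed from 0.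
\<close>

locale inductively_compact_group = group G for G (structure) +
  fixes K :: "nat \<Rightarrow> 'a topology"
  assumes subgroup_K: "subgroup (topspace (K n)) G"
    and compact_K: "compact_space (K n)"
    and metrizable_K: "metrizable_space (K n)"
    and continuous_mult_K:
      "continuous_map (prod_topology (K n) (K n)) (K n) (\<lambda>(g, h). g \<otimes> h)"
    and continuous_inv_K: "continuous_map (K n) (K n) (\<lambda>g. inv g)"
    and chain_K: "topspace (K n) \<subseteq> topspace (K (Suc n))"
    and subtopology_K: "K n = subtopology (K (Suc n)) (topspace (K n))"
    and carrier_eq: "carrier G = (\<Union>n. topspace (K n))"

definition inductive_limit_topology :: "(nat \<Rightarrow> 'g topology) \<Rightarrow> 'g topology" where
  "inductive_limit_topology K = topology (\<lambda>U. U \<subseteq> (\<Union>n. topspace (K n)) \<and>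
     (\<forall>n. openin (K n) (U \<inter> topspace (K n))))"

definition borel_algebra :: "'g topology \<Rightarrow> 'g set set" where
  "borel_algebra S = sigma_sets (topspace S) {U. openin S U}"

definition inductive_limit_borel :: "(nat \<Rightarrow> 'g topology) \<Rightarrow> 'g measure" where
  "inductive_limit_borel K = sigma (\<Union>n. topspace (K n)) (\<Union>n. borel_algebra (K n))"

text \<open>\<open>group_action\<close> takes each \<open>T g\<close> to be \<open>undefined\<close> outside \<open>space X\<close>.\<close>

definition measurable_action ::
    "('g, 'r) monoid_scheme \<Rightarrow> (nat \<Rightarrow> 'g topology) \<Rightarrow> 'x measure \<Rightarrow> ('g \<Rightarrow> 'x \<Rightarrow> 'x) \<Rightarrow> bool" where
  "measurable_action G K X T \<longleftrightarrow>
     group_action G (space X) T \<and>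
     (\<lambda>(g, x). T g x) \<in> measurable (inductive_limit_borel K \<Otimes>\<^sub>M X) X"

definition positive_cocycle ::
    "('g, 'r) monoid_scheme \<Rightarrow> (nat \<Rightarrow> 'g topology) \<Rightarrow> 'x measure \<Rightarrow> ('g \<Rightarrow> 'x \<Rightarrow> 'x) \<Rightarrow>
      ('g \<Rightarrow> 'x \<Rightarrow> real) \<Rightarrow> bool" where
  "positive_cocycle G K X T \<rho> \<longleftrightarrow>
     (\<lambda>(g, x). \<rho> g x) \<in> borel_measurable (inductive_limit_borel K \<Otimes>\<^sub>M X) \<and>
     (\<forall>g\<in>carrier G. \<forall>x\<in>space X. \<rho> g x > 0) \<and>
     (\<forall>g\<in>carrier G. \<forall>h\<in>carrier G. \<forall>x\<in>space X. \<rho> (g \<otimes>\<^bsub>G\<^esub> h) x = \<rho> g (T h x) * \<rho> h x)"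

text \<open>The measure \<open>A \<mapsto> \<nu> (t A)\<close>.\<close>

definition measure_comp :: "'x measure \<Rightarrow> ('x \<Rightarrow> 'x) \<Rightarrow> 'x measure" where
  "measure_comp \<nu> t = measure_of (space \<nu>) (sets \<nu>) (\<lambda>A. emeasure \<nu> (t ` A))"

text \<open>
  \<open>RN_deriv\<close> is 0 when no density exists, so absolute continuity is required separately.
\<close>

definition cocycle_measures ::
    "('g, 'r) monoid_scheme \<Rightarrow> 'x measure \<Rightarrow> ('g \<Rightarrow> 'x \<Rightarrow> 'x) \<Rightarrow> ('g \<Rightarrow> 'x \<Rightarrow> real) \<Rightarrow>
      'x measure set" where
  "cocycle_measures G X T \<rho> =
     {\<nu>. prob_space \<nu> \<and> sets \<nu> = sets X \<and>
        (\<forall>g\<in>carrier G. absolutely_continuous \<nu> (measure_comp \<nu> (T g)) \<and>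
           (AE x in \<nu>. RN_deriv \<nu> (measure_comp \<nu> (T g)) x = ennreal (\<rho> g x)))}"

definition ergodic ::
    "('g, 'r) monoid_scheme \<Rightarrow> 'x measure \<Rightarrow> ('g \<Rightarrow> 'x \<Rightarrow> 'x) \<Rightarrow> 'x measure \<Rightarrow> bool" where
  "ergodic G X T \<nu> \<longleftrightarrow>
     (\<forall>A\<in>sets X. (\<forall>g\<in>carrier G. T g ` A = A) \<longrightarrow>
        measure \<nu> A = 0 \<or> measure \<nu> (space X - A) = 0)"

definition indecomposable_in :: "'x measure set \<Rightarrow> 'x measure \<Rightarrow> bool" where
  "indecomposable_in \<M> \<nu> \<longleftrightarrow>
     (\<forall>\<alpha>\<in>{0<..<1}. \<forall>\<nu>1\<in>\<M>. \<forall>\<nu>2\<in>\<M>.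
        (\<forall>A\<in>sets \<nu>. measure \<nu> A = \<alpha> * measure \<nu>1 A + (1 - \<alpha>) * measure \<nu>2 A) \<longrightarrow>
        \<nu> = \<nu>1 \<and> \<nu> = \<nu>2)"

lemma measure_comp_eq_distr:
  assumes act: "measurable_action G K X T" and K: "inductively_compact_group G K"
    and \<nu>: "sets \<nu> = sets X" and g: "g \<in> carrier G"
  shows "T (inv\<^bsub>G\<^esub> g) \<in> measurable \<nu> \<nu>"
    and "measure_comp \<nu> (T g) = distr \<nu> \<nu> (T (inv\<^bsub>G\<^esub> g))"
proof -
  interpret inductively_compact_group G K by fact
  interpret group_action G "space X" T using act unfolding measurable_action_def by blast
  have sp: "space \<nu> = space X" by (rule sets_eq_imp_space_eq) fact
  have carr: "space (inductive_limit_borel K) = carrier G"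
    unfolding inductive_limit_borel_def carrier_eq by (simp add: space_measure_of_conv)
  have g': "inv\<^bsub>G\<^esub> g \<in> carrier G" using g by simp
  have "(\<lambda>(g, x). T g x) \<circ> Pair (inv\<^bsub>G\<^esub> g) \<in> measurable X X"
    using act g' carr unfolding measurable_action_def
    by (intro measurable_comp[OF measurable_Pair1']) auto
  then have "T (inv\<^bsub>G\<^esub> g) \<in> measurable X X" by (simp add: comp_def)
  then show "T (inv\<^bsub>G\<^esub> g) \<in> measurable \<nu> \<nu>"
    using \<nu> by (simp cong: measurable_cong_sets)
  have img: "T (inv\<^bsub>G\<^esub> g) -` A \<inter> space \<nu> = T g ` A" if A: "A \<in> sets \<nu>" for A
  proof -
    have AX: "A \<subseteq> space X" using sets.sets_into_space[OF A] sp by simp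
    show ?thesis
    proof (intro equalityI subsetI)
      fix x assume "x \<in> T (inv\<^bsub>G\<^esub> g) -` A \<inter> space \<nu>"
      then have "x = T g (T (inv\<^bsub>G\<^esub> g) x)" "T (inv\<^bsub>G\<^esub> g) x \<in> A"
        using orbit_sym_aux[OF g', of x] sp g by auto
      then show "x \<in> T g ` A" by blast
    next
      fix x assume "x \<in> T g ` A"
      then obtain y where y: "y \<in> A" "x = T g y" by blast
      then show "x \<in> T (inv\<^bsub>G\<^esub> g) -` A \<inter> space \<nu>"
        using orbit_sym_aux[OF g, of y x] AX element_image[OF g, of y x] sp by auto
    qed
  qed
  show "measure_comp \<nu> (T g) = distr \<nu> \<nu> (T (inv\<^bsub>G\<^esub> g))"
    unfolding measure_comp_def distr_def
    by (rule measure_of_eq) (auto simp: sets.sigma_sets_eq img dest: sets.sets_into_space)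
qed

lemma openin_inductive_limit_topology:
  "openin (inductive_limit_topology K) U \<longleftrightarrow>
     U \<subseteq> (\<Union>n. topspace (K n)) \<and> (\<forall>n. openin (K n) (U \<inter> topspace (K n)))"
proof -
  have "istopology (\<lambda>U. U \<subseteq> (\<Union>n. topspace (K n)) \<and> (\<forall>n. openin (K n) (U \<inter> topspace (K n))))"
    (is "istopology ?P")
    unfolding istopology_def
  proof (intro conjI allI impI)
    fix S T n assume ST: "?P S" "?P T"
    from ST(1) have "S \<subseteq> (\<Union>n. topspace (K n))" by (rule conjunct1)
    then show "S \<inter> T \<subseteq> (\<Union>n. topspace (K n))" by (rule le_infI1)
    have "openin (K n) ((S \<inter> topspace (K n)) \<inter> (T \<inter> topspace (K n)))"
      using ST(1)[THEN conjunct2, THEN spec, of n] ST(2)[THEN conjunct2, THEN spec, of n]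
      by (rule openin_Int)
    moreover have "(S \<inter> topspace (K n)) \<inter> (T \<inter> topspace (K n)) = S \<inter> T \<inter> topspace (K n)"
      by blast
    ultimately show "openin (K n) (S \<inter> T \<inter> topspace (K n))" by simp
  next
    fix \<K> n assume *: "Ball \<K> ?P"
    show "\<Union>\<K> \<subseteq> (\<Union>n. topspace (K n))" by (rule Union_least) (use * in blast)
    have "openin (K n) (\<Union>S\<in>\<K>. S \<inter> topspace (K n))"
      using * by (intro openin_Union) auto
    then show "openin (K n) (\<Union>\<K> \<inter> topspace (K n))"
      by (simp only: Int_Union2)
  qed
  then show ?thesis
    by (simp add: inductive_limit_topology_def topology_inverse')
qed

lemma topspace_inductive_limit_topology:
  "topspace (inductive_limit_topology K) = (\<Union>n. topspace (K n))"
proof -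
  have "openin (inductive_limit_topology K) (\<Union>n. topspace (K n))"
    unfolding openin_inductive_limit_topology
  proof (intro conjI allI)
    fix n
    have "(\<Union>n. topspace (K n)) \<inter> topspace (K n) = topspace (K n)" by blast
    then show "openin (K n) ((\<Union>n. topspace (K n)) \<inter> topspace (K n))" by simp
  qed simp
  then show ?thesis
    using openin_inductive_limit_topology[of K "topspace (inductive_limit_topology K)"]
    by (auto dest: openin_subset)
qed

context inductively_compact_group
begin

lemma chain_K_le: "m \<le> n \<Longrightarrow> topspace (K m) \<subseteq> topspace (K n)"
  by (rule lift_Suc_mono_le[of "\<lambda>n. topspace (K n)"]) (use chain_K in auto)

lemma subtopology_K_le: "m \<le> n \<Longrightarrow> K m = subtopology (K n) (topspace (K m))"
proof (induction n rule: dec_induct)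
  case base
  then show ?case by (metis subtopology_topspace)
next
  case (step n)
  have "K m = subtopology (subtopology (K (Suc n)) (topspace (K n))) (topspace (K m))"
    using step.IH subtopology_K[of n] by metis
  also have "\<dots> = subtopology (K (Suc n)) (topspace (K m))"
    using chain_K_le[OF step.hyps(1)] by (simp add: subtopology_subtopology Int_absorb1)
  finally show ?case .
qed

lemma closedin_K:
  assumes "closedin (K m) C"
  shows "closedin (K n) (C \<inter> topspace (K n))"
proof (cases "m \<le> n")
  case True
  have "compactin (K m) C"
    using assms compact_K closedin_compact_space by blast
  then have "compactin (subtopology (K n) (topspace (K m))) C"
    using subtopology_K_le[OF True] by metis
  then have "compactin (K n) C"
    by (simp add: compactin_subtopology)
  then have "closedin (K n) C"
    using metrizable_K[of n] metrizable_imp_Hausdorff_space compactin_imp_closedin by blast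
  then show ?thesis by blast
next
  case False
  then have "K n = subtopology (K m) (topspace (K n))"
    by (intro subtopology_K_le) simp
  then show ?thesis
    using assms by (metis closedin_subtopology)
qed

lemma closedin_inductive_limit_topology:
  assumes "closedin (K m) C"
  shows "closedin (inductive_limit_topology K) C"
proof -
  have ts: "topspace (inductive_limit_topology K) = (\<Union>n. topspace (K n))"
    by (rule topspace_inductive_limit_topology)
  have "openin (K n) (((\<Union>n. topspace (K n)) - C) \<inter> topspace (K n))" for n
  proof -
    have "((\<Union>n. topspace (K n)) - C) \<inter> topspace (K n) = topspace (K n) - C \<inter> topspace (K n)"
      by blast
    then show ?thesis using closedin_K[OF assms, of n] by (simp add: closedin_def)
  qed
  moreover have "C \<subseteq> (\<Union>n. topspace (K n))" using closedin_subset[OF assms] by blast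
  ultimately show ?thesis
    unfolding closedin_def ts openin_inductive_limit_topology by blast
qed

text \<open>The sigma-algebra on \<open>G\<close> is the Borel algebra of the inductive limit topology.\<close>

lemma sets_inductive_limit_borel:
  "sets (inductive_limit_borel K) = borel_algebra (inductive_limit_topology K)"
proof -
  let ?S = "\<Union>n. topspace (K n)" and ?L = "inductive_limit_topology K"
  have ts: "topspace ?L = ?S"
    by (rule topspace_inductive_limit_topology)
  have sub: "(\<Union>n. borel_algebra (K n)) \<subseteq> Pow ?S"
    proof
    fix A assume "A \<in> (\<Union>n. borel_algebra (K n))"
    then obtain n where "A \<in> borel_algebra (K n)" by blast
    moreover have "{U. openin (K n) U} \<subseteq> Pow (topspace (K n))" using openin_subset by blast
    ultimately have "A \<subseteq> topspace (K n)"
      unfolding borel_algebra_def using sigma_sets_into_sp by metis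
    then show "A \<in> Pow ?S" by blast
  qed
  have eq: "sets (inductive_limit_borel K) = sigma_sets ?S (\<Union>n. borel_algebra (K n))"
    unfolding inductive_limit_borel_def using sub by simp
  interpret L: sigma_algebra ?S "borel_algebra ?L"
    unfolding borel_algebra_def ts[symmetric]
    by (rule sigma_algebra_sigma_sets) (auto dest: openin_subset)
  have closed: "C \<in> borel_algebra ?L" if C: "closedin ?L C" for C
  proof -
    have "?S - C \<in> borel_algebra ?L"
      using C unfolding borel_algebra_def closedin_def ts by (auto intro: sigma_sets.Basic)
    then have "?S - (?S - C) \<in> borel_algebra ?L" by blast
    moreover have "?S - (?S - C) = C" using closedin_subset[OF C] ts by blast
    ultimately show ?thesis by simp
  qed
  have "A \<in> borel_algebra ?L" if "A \<in> borel_algebra (K n)" for A n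
    using that unfolding borel_algebra_def[of "K n"]
  proof (induction rule: sigma_sets.induct)
    case (Basic U)
    have "topspace (K n) - (topspace (K n) - U) = U"
      using Basic openin_subset by fastforce
    moreover have "topspace (K n) - (topspace (K n) - U) \<in> borel_algebra ?L"
      using Basic by (intro L.Diff closed closedin_inductive_limit_topology[of n]) auto
    ultimately show ?case by simp
  next
    case (Compl A)
    have "topspace (K n) \<in> borel_algebra ?L"
      by (intro closed closedin_inductive_limit_topology[of n]) simp
    then show ?case using Compl.IH by (rule L.Diff)
  qed (auto intro!: L.countable_UN)
  then have "sigma_sets ?S (\<Union>n. borel_algebra (K n)) \<subseteq> borel_algebra ?L"
    by (intro L.sigma_sets_subset) blast
  moreover have "U \<in> sigma_sets ?S (\<Union>n. borel_algebra (K n))" if "openin ?L U" for U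
  proof -
    have U: "U = (\<Union>n. U \<inter> topspace (K n))" "\<And>n. openin (K n) (U \<inter> topspace (K n))"
      using that unfolding openin_inductive_limit_topology by auto
    have "(\<Union>n. U \<inter> topspace (K n)) \<in> sigma_sets ?S (\<Union>n. borel_algebra (K n))"
      using U(2) by (intro sigma_sets.Union sigma_sets.Basic)
        (auto simp: borel_algebra_def intro: sigma_sets.Basic)
    then show ?thesis using U(1) by simp
  qed
  then have "borel_algebra ?L \<subseteq> sigma_sets ?S (\<Union>n. borel_algebra (K n))"
    unfolding borel_algebra_def[of ?L] ts by (intro sigma_sets_mono) auto
  ultimately show ?thesis using eq by simp
qed

end

end

theory Submission
  imports Defs
begin

text \<open>
  If \<open>\<nu> = \<alpha> \<nu>\<^sub>1 + (1 - \<alpha>) \<nu>\<^sub>2\<close>, then \<open>\<nu>\<^sub>1\<close> has a density \<open>f\<close> with respect to \<open>\<nu>\<close>, and since both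
  measures transform with the same cocycle, \<open>f \<circ> T g = f\<close> almost everywhere for each \<open>g\<close>. The set
  \<open>{f < 1}\<close> is thus invariant up to null sets depending on \<open>g\<close>. Ergodicity only concerns strictly
  invariant sets, so this set is first changed on a null set, using Fubini's theorem and the Haar
  measures of the groups \<open>K n\<close>. Then \<open>{f < 1}\<close> is null or conull, and \<open>\<integral> f d\<nu> = 1\<close> forces \<open>f = 1\<close>.
\<close>

lemma sigma_algebra_borel_algebra: "sigma_algebra (topspace S) (borel_algebra S)"
  unfolding borel_algebra_def by (rule sigma_algebra_sigma_sets) (auto dest: openin_subset)

lemma borel_algebra_openin: "openin S U \<Longrightarrow> U \<in> borel_algebra S"
  unfolding borel_algebra_def by (auto intro: sigma_sets.Basic)

subsection \<open>Measures from contents on closed sets\<close>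

text \<open>In a compact Hausdorff space the closed sets are exactly the compact ones, so
  \<open>l\<close> is a content in the classical sense. Additivity on disjoint sets is split into
  two inequalities that serve different ends: subadditivity yields the outer measure,
  superadditivity the Caratheodory condition.\<close>

locale closed_content =
  fixes S :: "'a topology" and l :: "'a set \<Rightarrow> ennreal"
  assumes compact: "compact_space S"
    and Hausdorff: "Hausdorff_space S"
    and content_empty: "l {} = 0"
    and content_mono: "\<lbrakk>closedin S C; closedin S D; C \<subseteq> D\<rbrakk> \<Longrightarrow> l C \<le> l D"
    and content_subadditive: "\<lbrakk>closedin S C; closedin S D\<rbrakk> \<Longrightarrow> l (C \<union> D) \<le> l C + l D"
    and content_superadditive:
      "\<lbrakk>closedin S C; closedin S D; C \<inter> D = {}\<rbrakk> \<Longrightarrow> l C + l D \<le> l (C \<union> D)"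
begin

text \<open>\<open>inner\<close> and \<open>outer\<close> are the inner content and the induced
  outer measure in the classical passage from a content to a Borel measure. Only values of
  \<open>inner\<close> at open sets matter.\<close>

definition inner :: "'a set \<Rightarrow> ennreal" where
  "inner U = (SUP C\<in>{C. closedin S C \<and> C \<subseteq> U}. l C)"

definition outer :: "'a set \<Rightarrow> ennreal" where
  "outer A = (INF U\<in>{U. openin S U \<and> A \<subseteq> U}. inner U)"

lemma inner_upper: "\<lbrakk>closedin S C; C \<subseteq> U\<rbrakk> \<Longrightarrow> l C \<le> inner U"
  unfolding inner_def by (rule SUP_upper) simp

lemma inner_mono: "U \<subseteq> V \<Longrightarrow> inner U \<le> inner V"
  unfolding inner_def by (rule SUP_subset_mono) auto

lemma inner_empty: "inner {} = 0"
proof -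
  have "{C. closedin S C \<and> C \<subseteq> {}} = {{}}" by auto
  then show ?thesis unfolding inner_def by (simp add: content_empty)
qed

lemma outer_le_inner: "\<lbrakk>openin S U; A \<subseteq> U\<rbrakk> \<Longrightarrow> outer A \<le> inner U"
  unfolding outer_def by (rule INF_lower) simp

lemma outer_eq_inner: "openin S U \<Longrightarrow> outer U = inner U"
  by (intro antisym outer_le_inner) (auto simp: outer_def intro!: INF_greatest inner_mono)

lemma outer_mono: "A \<subseteq> B \<Longrightarrow> outer A \<le> outer B"
  unfolding outer_def by (rule INF_superset_mono) auto

lemma outer_close: "outer A < e \<Longrightarrow> \<exists>U. openin S U \<and> A \<subseteq> U \<and> inner U < e"
  unfolding outer_def by (auto simp: INF_less_iff)

text \<open>The whole space is open and closed at once. This identity later fixes the total mass of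
  Haar measure.\<close>

lemma outer_topspace: "outer (topspace S) = l (topspace S)"
proof -
  have "inner (topspace S) \<le> l (topspace S)"
    unfolding inner_def by (rule SUP_least) (auto intro!: content_mono)
  moreover have "l (topspace S) \<le> inner (topspace S)" by (rule inner_upper) auto
  ultimately show ?thesis by (simp add: outer_eq_inner)
qed

text \<open>By normality the disjoint closed sets \<open>C - U\<close> and \<open>C - V\<close> have
  disjoint open neighbourhoods; removing each of these from \<open>C\<close> leaves the two
  pieces.\<close>

lemma closedin_split:
  assumes C: "closedin S C" and U: "openin S U" and V: "openin S V" and sub: "C \<subseteq> U \<union> V"
  obtains D E where "closedin S D" "closedin S E" "D \<subseteq> U" "E \<subseteq> V" "C = D \<union> E"
proof -
  have "normal_space S"
    using compact Hausdorff compact_Hausdorff_or_regular_imp_normal_space by blast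
  moreover have "closedin S (C - U)" "closedin S (C - V)" using C U V by auto
  moreover have "disjnt (C - U) (C - V)" using sub by (auto simp: disjnt_def)
  ultimately obtain U' V' where *: "openin S U'" "openin S V'" "C - U \<subseteq> U'" "C - V \<subseteq> V'" "disjnt U' V'"
    unfolding normal_space_def by meson
  show ?thesis
  proof
    show "closedin S (C - U')" "closedin S (C - V')" using C * by auto
    show "C - U' \<subseteq> U" "C - V' \<subseteq> V" "C = (C - U') \<union> (C - V')"
      using * by (auto simp: disjnt_def)
  qed
qed

lemma inner_Un:
  assumes U: "openin S U" and V: "openin S V"
  shows "inner (U \<union> V) \<le> inner U + inner V"
  unfolding inner_def[of "U \<union> V"]
proof (rule SUP_least, clarify)
  fix C assume "closedin S C" "C \<subseteq> U \<union> V"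
  then obtain D E where DE: "closedin S D" "closedin S E" "D \<subseteq> U" "E \<subseteq> V" "C = D \<union> E"
    using closedin_split[OF _ U V] by metis
  have "l C \<le> l D + l E" using content_subadditive DE by simp
  also have "\<dots> \<le> inner U + inner V" using DE by (intro add_mono inner_upper)
  finally show "l C \<le> inner U + inner V" .
qed

lemma inner_finite_UN:
  fixes U :: "nat \<Rightarrow> 'a set"
  assumes "\<And>i. openin S (U i)"
  shows "inner (\<Union>i<n. U i) \<le> (\<Sum>i<n. inner (U i))"
proof (induction n)
  case (Suc n)
  have "inner (\<Union>i<Suc n. U i) \<le> inner (\<Union>i<n. U i) + inner (U n)"
    unfolding lessThan_Suc UN_insert using inner_Un[of "\<Union>i<n. U i" "U n"] assms
    by (auto simp: Un_commute)
  also have "\<dots> \<le> (\<Sum>i<Suc n. inner (U i))" using Suc by (simp add: add_mono)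
  finally show ?case .
qed (simp add: inner_empty)

text \<open>A closed set inside the union is compact, hence already lies in finitely many of the
  \<open>U i\<close>.\<close>

lemma inner_UN:
  fixes U :: "nat \<Rightarrow> 'a set"
  assumes U: "\<And>i. openin S (U i)"
  shows "inner (\<Union>i. U i) \<le> (\<Sum>i. inner (U i))"
  unfolding inner_def[of "\<Union>i. U i"]
proof (rule SUP_least, clarify)
  fix C assume C: "closedin S C" "C \<subseteq> (\<Union>i. U i)"
  then have "compactin S C" using compact closedin_compact_space by blast
  then obtain \<F> where \<F>: "finite \<F>" "\<F> \<subseteq> range U" "C \<subseteq> \<Union>\<F>"
    using C(2) U unfolding compactin_def by (metis (no_types, lifting) image_iff)
  then obtain I where I: "finite I" "\<F> = U ` I" by (meson finite_subset_image)
  obtain n where n: "I \<subseteq> {..<n}" using I(1) finite_nat_bounded by blast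
  have "l C \<le> inner (\<Union>i<n. U i)" using \<F>(3) I(2) n by (intro inner_upper C(1)) blast
  also have "\<dots> \<le> (\<Sum>i<n. inner (U i))" using U by (rule inner_finite_UN)
  also have "\<dots> \<le> (\<Sum>i. inner (U i))" by (rule sum_le_suminf) auto
  finally show "l C \<le> (\<Sum>i. inner (U i))" .
qed

lemma outer_UN:
  fixes A :: "nat \<Rightarrow> 'a set"
  shows "outer (\<Union>i. A i) \<le> (\<Sum>i. outer (A i))"
proof (rule ennreal_le_epsilon)
  fix e :: real assume e: "0 < e" and "(\<Sum>i. outer (A i)) < Orderings.top"
  \<comment> \<open>A finite sum has finite terms, so adding a positive amount strictly increases
    each of them. The exponent \<open>Suc n\<close> makes the errors add up to exactly
    \<open>e\<close>.\<close>
  then have "outer (A n) < outer (A n) + e * (1/2)^Suc n" for n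
    by (auto simp add: less_top dest!: ennreal_suminf_lessD)
  then have "\<exists>U. openin S U \<and> A n \<subseteq> U \<and> inner U < outer (A n) + e * (1/2)^Suc n" for n
    by (rule outer_close)
  then obtain U where U: "\<And>n. openin S (U n)" "\<And>n. A n \<subseteq> U n"
      "\<And>n. inner (U n) < outer (A n) + e * (1/2)^Suc n"
    by metis
  have "outer (\<Union>i. A i) \<le> inner (\<Union>i. U i)"
    using U(1,2) by (intro outer_le_inner) auto
  also have "\<dots> \<le> (\<Sum>i. inner (U i))" using U(1) by (rule inner_UN)
  also have "\<dots> \<le> (\<Sum>i. outer (A i) + e * (1/2)^Suc i)"
    by (intro suminf_le less_imp_le U(3)) auto
  also have "\<dots> = (\<Sum>i. outer (A i)) + (\<Sum>i. ennreal e * ennreal ((1/2) ^ Suc i))"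
    using e by (subst suminf_add[symmetric])
      (auto simp del: ennreal_suminf_cmult simp add: ennreal_mult[symmetric])
  also have "\<dots> = (\<Sum>i. outer (A i)) + e"
    unfolding ennreal_suminf_cmult
    by (subst suminf_ennreal_eq[OF zero_le_power power_half_series]) auto
  finally show "outer (\<Union>i. A i) \<le> (\<Sum>i. outer (A i)) + e" .
qed

text \<open>Fix a closed \<open>C\<close> inside \<open>V \<inter> U\<close>. The open set
  \<open>V - C\<close> contains \<open>V - U\<close>, and its closed subsets \<open>D\<close> are
  disjoint from \<open>C\<close>, so superadditivity bounds \<open>l C + l D\<close> by
  \<open>inner V\<close>. Then suprema are taken over \<open>D\<close> and \<open>C\<close>.\<close>

lemma inner_split:
  assumes U: "openin S U" and V: "openin S V"
  shows "inner (V \<inter> U) + outer (V - U) \<le> inner V"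
proof -
  have "l C + outer (V - U) \<le> inner V" if C: "closedin S C" "C \<subseteq> V \<inter> U" for C
  proof -
    have "outer (V - U) \<le> inner (V - C)" using C V by (intro outer_le_inner) auto
    then have "l C + outer (V - U) \<le> l C + inner (V - C)" by (rule add_left_mono)
    also have "\<dots> = (SUP D\<in>{D. closedin S D \<and> D \<subseteq> V - C}. l C + l D)"
      unfolding inner_def by (rule ennreal_SUP_add_right) auto
    also have "\<dots> \<le> inner V"
    proof (rule SUP_least, clarify)
      fix D assume D: "closedin S D" "D \<subseteq> V - C"
      have "l C + l D \<le> l (C \<union> D)" using C D by (intro content_superadditive) auto
      also have "\<dots> \<le> inner V" using C D by (intro inner_upper) auto
      finally show "l C + l D \<le> inner V" .
    qed
    finally show ?thesis .
  qed
  then have "(SUP C\<in>{C. closedin S C \<and> C \<subseteq> V \<inter> U}. l C + outer (V - U)) \<le> inner V"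
    by (intro SUP_least) auto
  also have "(SUP C\<in>{C. closedin S C \<and> C \<subseteq> V \<inter> U}. l C + outer (V - U)) = inner (V \<inter> U) + outer (V - U)"
    unfolding inner_def[of "V \<inter> U"] by (rule ennreal_SUP_add_left) auto
  finally show ?thesis .
qed

lemma outer_measure_space_outer: "outer_measure_space (Pow (topspace S)) outer"
  using outer_mono outer_UN outer_eq_inner[of "{}"] inner_empty
  unfolding outer_measure_space_def positive_def increasing_def countably_subadditive_def
  by auto

text \<open>Since \<open>outer A\<close> is an infimum over open \<open>V\<close> around
  \<open>A\<close>, the Caratheodory condition reduces to open test sets, which is
  \<open>inner_split\<close>. The reverse inequality is countable subadditivity for two sets padded
  with empty ones by \<open>binaryset\<close>.\<close>

lemma openin_lambda_system:
  assumes U: "openin S U"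
  shows "U \<in> lambda_system (topspace S) (Pow (topspace S)) outer"
proof -
  interpret sigma_algebra "topspace S" "Pow (topspace S)" by (rule sigma_algebra_Pow)
  have "outer (A \<inter> U) + outer (A - U) = outer A" if "A \<subseteq> topspace S" for A
  proof (rule antisym)
    have "outer (A \<inter> U) + outer (A - U) \<le> inner V" if V: "openin S V" "A \<subseteq> V" for V
    proof -
      have "outer (A \<inter> U) \<le> inner (V \<inter> U)" using U V by (intro outer_le_inner) auto
      moreover have "outer (A - U) \<le> outer (V - U)" using V by (intro outer_mono) auto
      ultimately show ?thesis using inner_split[OF U V(1)] by (meson add_mono order_trans)
    qed
    then show "outer (A \<inter> U) + outer (A - U) \<le> outer A"
      unfolding outer_def[of A] by (intro INF_greatest) auto
    have "outer (\<Union>i. binaryset (A \<inter> U) (A - U) i) \<le> (\<Sum>i. outer (binaryset (A \<inter> U) (A - U) i))"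
      by (rule outer_UN)
    moreover have "(\<Sum>i. outer (binaryset (A \<inter> U) (A - U) i)) = outer (A \<inter> U) + outer (A - U)"
      by (rule suminf_binaryset_eq) (simp add: outer_eq_inner inner_empty)
    ultimately show "outer A \<le> outer (A \<inter> U) + outer (A - U)"
      by (simp add: UN_binaryset_eq Int_Diff_Un)
  qed
  then show ?thesis using openin_subset[OF U] unfolding lambda_system_eq by auto
qed

definition content_measure :: "'a measure" where
  "content_measure = measure_of (topspace S) (borel_algebra S) outer"

lemma
  shows space_content_measure: "space content_measure = topspace S"
    and sets_content_measure: "sets content_measure = borel_algebra S"
proof -
  interpret sigma_algebra "topspace S" "borel_algebra S" by (rule sigma_algebra_borel_algebra)
  show "space content_measure = topspace S" "sets content_measure = borel_algebra S"
    unfolding content_measure_def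
    by (simp_all add: space_closed sigma_sets_eq space_measure_of_conv)
qed

text \<open>\<open>measure_of\<close> falls back to the zero measure unless \<open>outer\<close> is
  countably additive on the Borel sets. Caratheodory gives additivity on the lambda system, which
  contains the open sets and hence all Borel sets.\<close>

lemma emeasure_content_measure:
  assumes "A \<in> borel_algebra S"
  shows "emeasure content_measure A = outer A"
proof -
  interpret P: sigma_algebra "topspace S" "Pow (topspace S)" by (rule sigma_algebra_Pow)
  interpret B: sigma_algebra "topspace S" "borel_algebra S" by (rule sigma_algebra_borel_algebra)
  let ?L = "lambda_system (topspace S) (Pow (topspace S)) outer"
  have L: "measure_space (topspace S) ?L outer"
    by (rule P.caratheodory_lemma) (rule outer_measure_space_outer)
  then interpret L: sigma_algebra "topspace S" ?L by (simp add: measure_space_def)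
  have "borel_algebra S \<subseteq> ?L"
    unfolding borel_algebra_def by (intro L.sigma_sets_subset) (auto intro: openin_lambda_system)
  then have "measure_space (topspace S) (borel_algebra S) outer"
    by (rule measure_down[OF L sigma_algebra_borel_algebra])
  then show ?thesis using assms unfolding content_measure_def measure_space_def
    by (intro emeasure_measure_of_sigma) auto
qed

end

subsection \<open>Right Haar measure on a compact group\<close>

text \<open>The topology is an explicit value rather than a type class instance, because the groups
  \<open>K n\<close> are all subsets of one type.\<close>

locale compact_group = group H for H :: "('a, 'b) monoid_scheme" (structure) +
  fixes S :: "'a topology"
  assumes carrier_eq_topspace: "carrier H = topspace S"
    and compact_S: "compact_space S"
    and Hausdorff_S: "Hausdorff_space S"
    and continuous_mult: "continuous_map (prod_topology S S) S (\<lambda>(g, h). g \<otimes> h)"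
    and continuous_inv: "continuous_map S S (\<lambda>g. inv g)"
begin

lemma continuous_right_translation:
  assumes "h \<in> carrier H"
  shows "continuous_map S S (\<lambda>g. g \<otimes> h)"
proof -
  have "continuous_map S (prod_topology S S) (\<lambda>g. (g, h))"
    using assms by (simp add: continuous_map_pairedI carrier_eq_topspace)
  from continuous_map_compose[OF this continuous_mult] show ?thesis by (simp add: comp_def)
qed

lemma continuous_div: "continuous_map (prod_topology S S) S (\<lambda>(g, h). g \<otimes> inv h)"
proof -
  have "continuous_map (prod_topology S S) (prod_topology S S) (\<lambda>p. (fst p, inv (snd p)))"
    using continuous_map_compose[OF continuous_map_snd continuous_inv, of S]
    by (intro continuous_map_pairedI continuous_map_fst) (simp add: comp_def)
  from continuous_map_compose[OF this continuous_mult] show ?thesis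
    by (simp add: comp_def case_prod_unfold)
qed

text \<open>Turns openness, closedness and measurability of translates into statements about
  preimages under translation by \<open>inv h\<close>.\<close>

lemma translate_eq_preimage:
  assumes "A \<subseteq> carrier H" "h \<in> carrier H"
  shows "A #> h = {g \<in> topspace S. g \<otimes> inv h \<in> A}"
proof (intro equalityI subsetI)
  fix x assume "x \<in> A #> h"
  then obtain a where "a \<in> A" "x = a \<otimes> h" unfolding r_coset_def by auto
  then show "x \<in> {g \<in> topspace S. g \<otimes> inv h \<in> A}"
    using assms by (auto simp: carrier_eq_topspace[symmetric] m_assoc)
next
  fix x assume "x \<in> {g \<in> topspace S. g \<otimes> inv h \<in> A}"
  then have x: "x \<in> carrier H" "x \<otimes> inv h \<in> A" by (auto simp: carrier_eq_topspace)
  then have "x = (x \<otimes> inv h) \<otimes> h" using assms by (simp add: m_assoc)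
  with x(2) show "x \<in> A #> h" unfolding r_coset_def by blast
qed

lemma openin_translate:
  assumes "openin S U" "h \<in> carrier H"
  shows "openin S (U #> h)"
  using openin_continuous_map_preimage[OF continuous_right_translation[of "inv h"] assms(1)]
    translate_eq_preimage[of U h] assms openin_subset[OF assms(1)] inv_closed[of h]
  by (simp add: carrier_eq_topspace)

lemma closedin_translate:
  assumes "closedin S U" "h \<in> carrier H"
  shows "closedin S (U #> h)"
  using closedin_continuous_map_preimage[OF continuous_right_translation[of "inv h"] assms(1)]
    translate_eq_preimage[of U h] assms closedin_subset[OF assms(1)] inv_closed[of h]
  by (simp add: carrier_eq_topspace)

section \<open>Covering numbers by translates of a neighbourhood of the identity\<close>

definition covers :: "'a set \<Rightarrow> 'a set \<Rightarrow> 'a set \<Rightarrow> bool" where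
  "covers V A F \<longleftrightarrow> finite F \<and> F \<subseteq> carrier H \<and> A \<subseteq> (\<Union>f\<in>F. V #> f)"

text \<open>Haar's index \<open>(A : V)\<close>. The \<open>LEAST\<close> is meaningful only when
  some finite cover exists, which \<open>ex_covers\<close> provides.\<close>

definition covering_number :: "'a set \<Rightarrow> 'a set \<Rightarrow> nat" where
  "covering_number V A = (LEAST n. \<exists>F. covers V A F \<and> card F = n)"

definition nbhd :: "'a set \<Rightarrow> bool" where
  "nbhd V \<longleftrightarrow> openin S V \<and> \<one> \<in> V"

lemma nbhd_subset: "nbhd V \<Longrightarrow> V \<subseteq> carrier H"
  unfolding nbhd_def carrier_eq_topspace by (auto dest: openin_subset)

text \<open>As \<open>V\<close> contains the identity, every \<open>f\<close> lies in
  \<open>V #> f\<close>, so the translates form an open cover of the compact group.\<close>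

lemma ex_covers:
  assumes V: "nbhd V" and A: "A \<subseteq> carrier H"
  shows "\<exists>F. covers V A F"
proof -
  have "carrier H \<subseteq> (\<Union>f\<in>carrier H. V #> f)"
    using V unfolding nbhd_def r_coset_def by force
  moreover have "openin S U" if "U \<in> (\<lambda>f. V #> f) ` carrier H" for U
    using that V openin_translate unfolding nbhd_def by blast
  moreover have "compactin S (carrier H)"
    using compact_S unfolding carrier_eq_topspace compact_space_def .
  ultimately obtain \<F> where \<F>: "finite \<F>" "\<F> \<subseteq> (\<lambda>f. V #> f) ` carrier H" "carrier H \<subseteq> \<Union>\<F>"
    using compactinD[of S "carrier H" "(\<lambda>f. V #> f) ` carrier H"] by blast
  then obtain F where "F \<subseteq> carrier H" "finite F" "\<F> = (\<lambda>f. V #> f) ` F"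
    by (metis finite_subset_image)
  then have "covers V A F" using \<F>(3) A unfolding covers_def by auto
  then show ?thesis ..
qed

lemma covering_number_le: "covers V A F \<Longrightarrow> covering_number V A \<le> card F"
  unfolding covering_number_def by (rule Least_le) blast

lemma covering_number_attained:
  assumes "nbhd V" "A \<subseteq> carrier H"
  obtains F where "covers V A F" "card F = covering_number V A"
proof -
  have "\<exists>n F. covers V A F \<and> card F = n" using ex_covers[OF assms] by blast
  then have "\<exists>F. covers V A F \<and> card F = covering_number V A"
    unfolding covering_number_def by (rule LeastI_ex)
  then show ?thesis using that by blast
qed

lemma covering_number_empty: "covering_number V {} = 0"
  using covering_number_le[of V "{}" "{}"] by (simp add: covers_def)

lemma covering_number_mono:
  assumes "nbhd V" "A \<subseteq> B" "B \<subseteq> carrier H"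
  shows "covering_number V A \<le> covering_number V B"
proof -
  obtain F where "covers V B F" "card F = covering_number V B"
    using covering_number_attained assms by metis
  then show ?thesis using covering_number_le[of V A F] assms(2) unfolding covers_def by auto
qed

text \<open>Keeps the denominator of the later covering ratios nonzero; the group is nonempty, so no
  cover of it is empty.\<close>

lemma covering_number_carrier_pos:
  assumes "nbhd V"
  shows "covering_number V (carrier H) > 0"
proof -
  obtain F where F: "covers V (carrier H) F" "card F = covering_number V (carrier H)"
    using covering_number_attained assms by (metis order_refl)
  then have "F \<noteq> {}" "finite F" using one_closed unfolding covers_def by auto
  then show ?thesis using F(2) by (metis card_gt_0_iff)
qed

lemma covering_number_Un:
  assumes V: "nbhd V" and "A \<subseteq> carrier H" "B \<subseteq> carrier H"
  shows "covering_number V (A \<union> B) \<le> covering_number V A + covering_number V B"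
proof -
  obtain E where E: "covers V A E" "card E = covering_number V A"
    using covering_number_attained assms(1,2) by metis
  obtain F where F: "covers V B F" "card F = covering_number V B"
    using covering_number_attained assms(1,3) by metis
  have "covers V (A \<union> B) (E \<union> F)" using E(1) F(1) unfolding covers_def by auto
  then show ?thesis using covering_number_le[of V "A \<union> B" "E \<union> F"] card_Un_le[of E F] E(2) F(2)
    by simp
qed

text \<open>Each translate of \<open>V\<close> meets at most one of the two sets, so an optimal
  cover of the union splits into disjoint covers of \<open>A\<close> and of
  \<open>B\<close>.\<close>

lemma covering_number_Un_separated:
  assumes V: "nbhd V" and A: "A \<subseteq> carrier H" and B: "B \<subseteq> carrier H"
    and sep: "\<And>f. f \<in> carrier H \<Longrightarrow> (V #> f) \<inter> A = {} \<or> (V #> f) \<inter> B = {}"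
  shows "covering_number V A + covering_number V B \<le> covering_number V (A \<union> B)"
proof -
  obtain F where F: "covers V (A \<union> B) F" "card F = covering_number V (A \<union> B)"
    using covering_number_attained[OF V] A B by (metis Un_least)
  define E where "E = {f \<in> F. (V #> f) \<inter> A \<noteq> {}}"
  have fin: "finite F" "F \<subseteq> carrier H" and cov: "A \<union> B \<subseteq> (\<Union>f\<in>F. V #> f)"
    using F(1) unfolding covers_def by auto
  have E: "E \<subseteq> F" unfolding E_def by auto
  have "A \<subseteq> (\<Union>f\<in>E. V #> f)"
  proof
    fix x assume x: "x \<in> A"
    then obtain f where "f \<in> F" "x \<in> V #> f" using cov by auto
    then show "x \<in> (\<Union>f\<in>E. V #> f)" using x unfolding E_def by auto
  qed
  then have "covers V A E" using fin E finite_subset unfolding covers_def by auto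
  moreover have "B \<subseteq> (\<Union>f\<in>F - E. V #> f)"
  proof
    fix x assume x: "x \<in> B"
    then obtain f where f: "f \<in> F" "x \<in> V #> f" using cov by auto
    then have "f \<notin> E" using x sep[of f] fin(2) unfolding E_def by auto
    then show "x \<in> (\<Union>f\<in>F - E. V #> f)" using f by auto
  qed
  then have "covers V B (F - E)" using fin unfolding covers_def by auto
  moreover have "card E + card (F - E) = card F"
    using fin(1) E by (metis card_Diff_subset card_mono finite_subset le_add_diff_inverse)
  ultimately show ?thesis using covering_number_le F(2) by (metis add_mono)
qed

text \<open>Multiplying on the right by \<open>h\<close> turns a cover by sets \<open>V #> f\<close>
  into one by sets \<open>V #> (f \<otimes> h)\<close>. Covering by right translates is thus what
  makes the resulting measure right invariant.\<close>

lemma covering_number_translate_le: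
  assumes V: "nbhd V" and A: "A \<subseteq> carrier H" and h: "h \<in> carrier H"
  shows "covering_number V (A #> h) \<le> covering_number V A"
proof -
  obtain F where F: "covers V A F" "card F = covering_number V A"
    using covering_number_attained[OF V A] by metis
  have "A #> h \<subseteq> (\<Union>f\<in>F. V #> f) #> h"
    using F(1) unfolding covers_def r_coset_def by blast
  also have "\<dots> = (\<Union>f\<in>F. (V #> f) #> h)" unfolding r_coset_def by blast
  also have "\<dots> = (\<Union>f\<in>F. V #> (f \<otimes> h))"
    using F(1) h nbhd_subset[OF V] unfolding covers_def by (auto simp: coset_mult_assoc subset_iff)
  finally have "covers V (A #> h) ((\<lambda>f. f \<otimes> h) ` F)"
    using F(1) h unfolding covers_def by auto
  then have "covering_number V (A #> h) \<le> card ((\<lambda>f. f \<otimes> h) ` F)" by (rule covering_number_le)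
  also have "\<dots> \<le> card F" using F(1) unfolding covers_def by (intro card_image_le) auto
  finally show ?thesis using F(2) by simp
qed

lemma covering_number_translate:
  assumes V: "nbhd V" and A: "A \<subseteq> carrier H" and h: "h \<in> carrier H"
  shows "covering_number V (A #> h) = covering_number V A"
proof (rule antisym)
  have "A = (A #> h) #> inv h" using A h by (simp add: coset_mult_assoc)
  then show "covering_number V A \<le> covering_number V (A #> h)"
    using covering_number_translate_le[OF V, of "A #> h" "inv h"] A h by (simp add: r_coset_subset_G)
qed (rule covering_number_translate_le[OF assms])

text \<open>If \<open>v \<otimes> f\<close> lies in \<open>C\<close> and
  \<open>w \<otimes> f\<close> in \<open>D\<close>, then \<open>v \<otimes> inv w\<close> is a
  quotient of an element of \<open>C\<close> by one of \<open>D\<close>. These quotients form a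
  compact, hence closed, set that misses the identity, so by continuity of division they are avoided
  for \<open>v\<close> and \<open>w\<close> near the identity.\<close>

lemma ex_separating_nbhd:
  assumes C: "closedin S C" and D: "closedin S D" and CD: "C \<inter> D = {}"
  shows "\<exists>W. nbhd W \<and> (\<forall>V f. V \<subseteq> W \<longrightarrow> f \<in> carrier H \<longrightarrow> (V #> f) \<inter> C = {} \<or> (V #> f) \<inter> D = {})"
proof -
  let ?q = "\<lambda>(g, h). g \<otimes> inv h"
  have sub: "C \<subseteq> carrier H" "D \<subseteq> carrier H"
    using C D unfolding carrier_eq_topspace by (auto dest: closedin_subset)
  have "compactin (prod_topology S S) (C \<times> D)"
    using closedin_compact_space[OF compact_S] C D by (simp add: compactin_Times)
  then have "compactin S (?q ` (C \<times> D))"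
    using image_compactin continuous_div by blast
  then have "closedin S (?q ` (C \<times> D))"
    using Hausdorff_S compactin_imp_closedin by blast
  define N where "N = {p \<in> topspace (prod_topology S S). ?q p \<in> topspace S - ?q ` (C \<times> D)}"
  have "openin (prod_topology S S) N"
    unfolding N_def using \<open>closedin S (?q ` (C \<times> D))\<close>
    by (intro openin_continuous_map_preimage[OF continuous_div]) auto
  have "\<one> \<notin> ?q ` (C \<times> D)"
  proof
    assume "\<one> \<in> ?q ` (C \<times> D)"
    then obtain c d where cd: "c \<in> C" "d \<in> D" "\<one> = c \<otimes> inv d" by auto
    then have "c = d" using sub by (metis inv_equality inv_inv inv_closed subsetD)
    with cd CD show False by blast
  qed
  then have "(\<one>, \<one>) \<in> N"
    using one_closed by (simp add: N_def carrier_eq_topspace[symmetric])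
  with \<open>openin (prod_topology S S) N\<close> obtain U1 U2 where U: "openin S U1" "openin S U2" "\<one> \<in> U1" "\<one> \<in> U2"
      "U1 \<times> U2 \<subseteq> N"
    unfolding openin_prod_topology_alt by metis
  have "(V #> f) \<inter> C = {} \<or> (V #> f) \<inter> D = {}" if V: "V \<subseteq> U1 \<inter> U2" and f: "f \<in> carrier H" for V f
  proof (rule ccontr)
    assume "\<not> ?thesis"
    then obtain v w where vw: "v \<in> V" "w \<in> V" "v \<otimes> f \<in> C" "w \<otimes> f \<in> D"
      unfolding r_coset_def by blast
    have carr: "v \<in> carrier H" "w \<in> carrier H"
      using vw(1,2) V openin_subset[OF U(1)] unfolding carrier_eq_topspace by auto
    have "(v \<otimes> f) \<otimes> inv (w \<otimes> f) = v \<otimes> (f \<otimes> inv f) \<otimes> inv w"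
      using carr f by (simp only: inv_mult_group m_assoc m_closed inv_closed)
    then have "(v \<otimes> f) \<otimes> inv (w \<otimes> f) = v \<otimes> inv w" using carr f by simp
    moreover have "(v, w) \<in> N" using U(5) vw(1,2) V by blast
    then have "v \<otimes> inv w \<notin> ?q ` (C \<times> D)" unfolding N_def by simp
    moreover have "?q (v \<otimes> f, w \<otimes> f) \<in> ?q ` (C \<times> D)"
      using vw(3,4) by (intro imageI SigmaI)
    ultimately show False by simp
  qed
  moreover have "nbhd (U1 \<inter> U2)" using U unfolding nbhd_def by auto
  ultimately show ?thesis by blast
qed

text \<open>
  The Haar content is a cluster point, as \<open>V\<close> shrinks to the identity, of the ratios
  \<open>(A : V) / (H : V)\<close> in the compact space of functions from sets to \<open>[0, 1]\<close>.
\<close>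

definition covering_ratio :: "'a set \<Rightarrow> 'a set \<Rightarrow> real" where
  "covering_ratio V A = covering_number V (A \<inter> carrier H) / covering_number V (carrier H)"

definition small_nbhds :: "'a set filter" where
  "small_nbhds = (INF W\<in>Collect nbhd. principal {V. nbhd V \<and> V \<subseteq> W})"

lemma nbhd_carrier: "nbhd (carrier H)"
  using one_closed by (simp add: nbhd_def carrier_eq_topspace)

lemma eventually_small_nbhds:
  "eventually P small_nbhds \<longleftrightarrow> (\<exists>W. nbhd W \<and> (\<forall>V. nbhd V \<longrightarrow> V \<subseteq> W \<longrightarrow> P V))"
proof -
  have "nbhd (V \<inter> W)" if "nbhd V" "nbhd W" for V W
    using that unfolding nbhd_def by auto
  then show ?thesis unfolding small_nbhds_def using nbhd_carrier
    by (subst eventually_INF_base) (auto simp: eventually_principal)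
qed

lemma eventually_small_nbhdsI: "(\<And>V. nbhd V \<Longrightarrow> P V) \<Longrightarrow> eventually P small_nbhds"
  unfolding eventually_small_nbhds using nbhd_carrier by blast

lemma small_nbhds_neq_bot: "small_nbhds \<noteq> Orderings.bot"
  unfolding trivial_limit_def eventually_small_nbhds by blast

text \<open>By Tychonoff the product of unit intervals is compact, so the ratios have a cluster
  point there. Every closed condition that holds for all small \<open>V\<close> passes to it;
  nothing else about \<open>l\<close> is used later.\<close>

lemma ex_limit_of_covering_ratios:
  "\<exists>l. \<forall>P. closed {r. P r} \<longrightarrow> (\<forall>\<^sub>F V in small_nbhds. P (covering_ratio V)) \<longrightarrow> P l"
proof -
  let ?B = "PiE UNIV (\<lambda>_. {0..1}) :: ('a set \<Rightarrow> real) set"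
  let ?F = "filtermap covering_ratio small_nbhds"
  have "compactin (product_topology (\<lambda>_. euclidean) UNIV) ?B"
    by (subst compactin_PiE) auto
  then have "compact ?B" by (simp add: euclidean_product_topology)
  moreover have "?F \<noteq> Orderings.bot" using small_nbhds_neq_bot by (simp add: filtermap_bot_iff)
  \<comment> \<open>The intersection with \<open>carrier H\<close> in \<open>covering_ratio\<close>
    bounds the ratio by 1 even for sets not contained in the group.\<close>
  moreover have "covering_ratio V \<in> ?B" if "nbhd V" for V
  proof -
    have "covering_number V (A \<inter> carrier H) \<le> covering_number V (carrier H)" for A
      using that by (intro covering_number_mono) auto
    then show ?thesis using covering_number_carrier_pos[OF that] by (auto simp: covering_ratio_def)
  qed
  then have "\<forall>\<^sub>F r in ?F. r \<in> ?B"
    unfolding eventually_filtermap by (rule eventually_small_nbhdsI)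
  ultimately obtain l where l: "inf (nhds l) ?F \<noteq> Orderings.bot" unfolding compact_filter by blast
  have "P l" if "closed {r. P r}" "\<forall>\<^sub>F V in small_nbhds. P (covering_ratio V)" for P
  proof (rule ccontr)
    assume "\<not> P l"
    then have "\<forall>\<^sub>F r in nhds l. \<not> P r"
      using that(1) unfolding eventually_nhds closed_def by (intro exI[of _ "- {r. P r}"]) auto
    moreover have "\<forall>\<^sub>F r in ?F. P r" using that(2) by (simp add: eventually_filtermap)
    ultimately have "\<forall>\<^sub>F r in inf (nhds l) ?F. False"
      unfolding eventually_inf by blast
    with l show False by (simp add: trivial_limit_def)
  qed
  then show ?thesis by blast
qed

text \<open>Every property wanted of \<open>l\<close> is a closed condition on finitely many
  coordinates, so it passes from the ratios to the cluster point. Superadditivity holds for the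
  ratios only once \<open>V\<close> is small enough to separate \<open>C\<close> from
  \<open>D\<close>.\<close>

lemma ex_invariant_content:
  "\<exists>l. closed_content S l \<and> l (carrier H) = 1 \<and>
     (\<forall>A h. A \<subseteq> carrier H \<longrightarrow> h \<in> carrier H \<longrightarrow> l (A #> h) = l A)"
proof -
  obtain l where lim:
      "\<And>P. closed {r. P r} \<Longrightarrow> \<forall>\<^sub>F V in small_nbhds. P (covering_ratio V) \<Longrightarrow> P l"
    using ex_limit_of_covering_ratios by blast
  note ev = eventually_small_nbhdsI
  note closed = closed_Collect_le closed_Collect_eq continuous_on_add continuous_on_const
    continuous_on_product_coordinates
  have nonneg: "0 \<le> l A" for A
    by (rule lim) (intro closed, rule ev, simp add: covering_ratio_def)
  have carrier: "l (carrier H) = 1"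
    by (rule lim) (intro closed, rule ev, use covering_number_carrier_pos in \<open>force simp: covering_ratio_def\<close>)
  have empty: "l {} = 0"
    by (rule lim) (intro closed, rule ev, simp add: covering_ratio_def covering_number_empty)
  have mono: "l A \<le> l B" if "A \<subseteq> B" for A B
  proof (rule lim)
    show "\<forall>\<^sub>F V in small_nbhds. covering_ratio V A \<le> covering_ratio V B"
      using that unfolding covering_ratio_def
      by (intro ev divide_right_mono of_nat_mono covering_number_mono) auto
  qed (intro closed)
  have subadditive: "l (A \<union> B) \<le> l A + l B" for A B
  proof (rule lim, intro closed, rule ev)
    fix V assume "nbhd V"
    then have "covering_number V ((A \<union> B) \<inter> carrier H)
        \<le> covering_number V (A \<inter> carrier H) + covering_number V (B \<inter> carrier H)"
      unfolding Int_Un_distrib2 by (intro covering_number_Un) auto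
    then show "covering_ratio V (A \<union> B) \<le> covering_ratio V A + covering_ratio V B"
      unfolding covering_ratio_def add_divide_distrib[symmetric] of_nat_add[symmetric]
      by (intro divide_right_mono of_nat_mono) auto
  qed
  have superadditive: "l C + l D \<le> l (C \<union> D)"
    if CD: "closedin S C" "closedin S D" "C \<inter> D = {}" for C D
  proof (rule lim, intro closed)
    have sub: "C \<subseteq> carrier H" "D \<subseteq> carrier H"
      using CD closedin_subset unfolding carrier_eq_topspace by auto
    obtain W where W: "nbhd W"
        "\<And>V f. V \<subseteq> W \<Longrightarrow> f \<in> carrier H \<Longrightarrow> (V #> f) \<inter> C = {} \<or> (V #> f) \<inter> D = {}"
      using ex_separating_nbhd[OF CD] by blast
    have "covering_ratio V C + covering_ratio V D \<le> covering_ratio V (C \<union> D)"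
      if V: "nbhd V" "V \<subseteq> W" for V
    proof -
      have "covering_number V C + covering_number V D \<le> covering_number V (C \<union> D)"
        using covering_number_Un_separated[OF V(1) sub] W(2)[OF V(2)] by blast
      then show ?thesis
        using sub unfolding covering_ratio_def add_divide_distrib[symmetric] of_nat_add[symmetric]
        by (intro divide_right_mono of_nat_mono) (auto simp: Int_absorb2)
    qed
    then show "\<forall>\<^sub>F V in small_nbhds. covering_ratio V C + covering_ratio V D \<le> covering_ratio V (C \<union> D)"
      unfolding eventually_small_nbhds using W(1) by blast
  qed
  have translate: "l (A #> h) = l A" if "A \<subseteq> carrier H" "h \<in> carrier H" for A h
  proof (rule lim, intro closed, rule ev)
    fix V assume "nbhd V"
    then show "covering_ratio V (A #> h) = covering_ratio V A"
      using that r_coset_subset_G[OF that] unfolding covering_ratio_def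
      by (simp add: Int_absorb2 covering_number_translate)
  qed
  have "closed_content S (\<lambda>A. ennreal (l A))"
    by unfold_locales
      (use compact_S Hausdorff_S nonneg empty mono subadditive superadditive in
        \<open>auto simp: ennreal_plus[symmetric] simp del: ennreal_plus intro!: ennreal_leI\<close>)
  then show ?thesis using carrier translate by (intro exI[of _ "\<lambda>A. ennreal (l A)"]) auto
qed

lemma r_coset_cancel:
  assumes "A \<subseteq> carrier H" "h \<in> carrier H"
  shows "A #> h #> inv h = A" "A #> inv h #> h = A"
  using assms by (simp_all add: coset_mult_assoc)

text \<open>Invariance passes from the content to \<open>inner\<close> and then to
  \<open>outer\<close>, since translates of closed or open sets are again closed or open. At each
  level one inequality suffices: applied to the translate and \<open>inv h\<close>, it gives the
  reverse.\<close>

theorem ex_haar_measure: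
  "\<exists>m. prob_space m \<and> space m = topspace S \<and> sets m = borel_algebra S \<and>
     (\<forall>h\<in>carrier H. (\<lambda>g. g \<otimes> h) \<in> measurable m m \<and> distr m m (\<lambda>g. g \<otimes> h) = m)"
proof -
  obtain l where l: "closed_content S l" and carrier: "l (carrier H) = 1"
    and translate: "\<And>A h. A \<subseteq> carrier H \<Longrightarrow> h \<in> carrier H \<Longrightarrow> l (A #> h) = l A"
    using ex_invariant_content by blast
  interpret closed_content S l by (rule l)
  define m where "m = content_measure"
  have sp: "space m = topspace S" and st: "sets m = borel_algebra S"
    unfolding m_def by (rule space_content_measure, rule sets_content_measure)
  have inner_le: "inner U \<le> inner (U #> h)" if "h \<in> carrier H" for U h
    unfolding inner_def[of U]
  proof (rule SUP_least, clarify)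
    fix C assume C: "closedin S C" "C \<subseteq> U"
    then have "C \<subseteq> carrier H" unfolding carrier_eq_topspace by (auto dest: closedin_subset)
    then have "l C = l (C #> h)" using translate that by simp
    also have "\<dots> \<le> inner (U #> h)"
      using C that by (intro inner_upper closedin_translate) (auto simp: r_coset_def)
    finally show "l C \<le> inner (U #> h)" .
  qed
  have outer_le: "outer (A #> h) \<le> outer A" if A: "A \<subseteq> carrier H" and h: "h \<in> carrier H" for A h
    unfolding outer_def[of A]
  proof (rule INF_greatest, clarify)
    fix U assume U: "openin S U" "A \<subseteq> U"
    then have "U \<subseteq> carrier H" unfolding carrier_eq_topspace by (auto dest: openin_subset)
    then have "inner (U #> h) \<le> inner U"
      using inner_le[of "inv h" "U #> h"] h by (simp add: r_coset_cancel)
    moreover have "outer (A #> h) \<le> inner (U #> h)"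
      using U h by (intro outer_le_inner openin_translate) (auto simp: r_coset_def)
    ultimately show "outer (A #> h) \<le> inner U" by (rule order_trans[rotated])
  qed
  have outer_translate: "outer (A #> h) = outer A" if A: "A \<subseteq> carrier H" and h: "h \<in> carrier H" for A h
    using outer_le[OF A h] outer_le[of "A #> h" "inv h"] A h
    by (simp add: r_coset_cancel r_coset_subset_G antisym)
  have "prob_space m"
  proof
    have "topspace S \<in> borel_algebra S" by (rule borel_algebra_openin) simp
    then show "emeasure m (space m) = 1"
      using carrier unfolding sp
      by (simp add: m_def emeasure_content_measure outer_topspace carrier_eq_topspace)
  qed
  moreover have "(\<lambda>g. g \<otimes> h) \<in> measurable m m \<and> distr m m (\<lambda>g. g \<otimes> h) = m" if h: "h \<in> carrier H" for h
  proof
    show meas: "(\<lambda>g. g \<otimes> h) \<in> measurable m m"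
    proof (rule measurable_sigma_sets)
      show "sets m = sigma_sets (topspace S) {U. openin S U}" by (simp add: st borel_algebra_def)
      show "{U. openin S U} \<subseteq> Pow (topspace S)" by (auto dest: openin_subset)
      show "(\<lambda>g. g \<otimes> h) \<in> space m \<rightarrow> topspace S"
        using h by (auto simp: sp carrier_eq_topspace[symmetric])
      fix U assume "U \<in> {U. openin S U}"
      then have "openin S {g \<in> topspace S. g \<otimes> h \<in> U}"
        by (intro openin_continuous_map_preimage[OF continuous_right_translation[OF h]]) auto
      moreover have "(\<lambda>g. g \<otimes> h) -` U \<inter> space m = {g \<in> topspace S. g \<otimes> h \<in> U}" by (auto simp: sp)
      ultimately show "(\<lambda>g. g \<otimes> h) -` U \<inter> space m \<in> sets m"
        by (simp add: st borel_algebra_openin)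
    qed
    show "distr m m (\<lambda>g. g \<otimes> h) = m"
    proof (rule measure_eqI)
      fix A assume "A \<in> sets (distr m m (\<lambda>g. g \<otimes> h))"
      then have A: "A \<in> sets m" by simp
      then have sub: "A \<subseteq> carrier H"
        using sets.sets_into_space sp carrier_eq_topspace by metis
      have pre: "(\<lambda>g. g \<otimes> h) -` A \<inter> space m = A #> inv h"
        using translate_eq_preimage[OF sub inv_closed[OF h]] h by (auto simp: sp)
      have "A #> inv h \<in> sets m" using measurable_sets[OF meas A] pre by simp
      then show "emeasure (distr m m (\<lambda>g. g \<otimes> h)) A = emeasure m A"
        using A meas pre sub h st outer_translate
        by (simp add: emeasure_distr m_def emeasure_content_measure)
    qed simp
  qed
  ultimately show ?thesis using sp st by blast
qed

end

subsection \<open>Cocycle measures of inductively compact groups\<close>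

context inductively_compact_group
begin

lemma compact_group_K: "compact_group (G\<lparr>carrier := topspace (K n)\<rparr>) (K n)"
proof -
  let ?H = "G\<lparr>carrier := topspace (K n)\<rparr>"
  interpret H: group ?H
    using subgroup_K by (rule subgroup.subgroup_is_group) (rule is_group)
  show ?thesis
  proof
    show "Hausdorff_space (K n)"
      by (rule metrizable_imp_Hausdorff_space) (rule metrizable_K)
    \<comment> \<open>Inversion in the restricted record refers to the smaller carrier and has to be
      identified with inversion in \<open>G\<close>.\<close>
    show "continuous_map (K n) (K n) (\<lambda>g. inv\<^bsub>?H\<^esub> g)"
      by (rule continuous_map_eq[OF continuous_inv_K]) (simp add: m_inv_consistent[OF subgroup_K])
  qed (use compact_K continuous_mult_K in simp_all)
qed

lemma ex_haar_measure_K: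
  "\<exists>m. prob_space m \<and> space m = topspace (K n) \<and> sets m = borel_algebra (K n) \<and>
     (\<forall>h\<in>topspace (K n). (\<lambda>g. g \<otimes> h) \<in> measurable m m \<and> distr m m (\<lambda>g. g \<otimes> h) = m)"
  using compact_group.ex_haar_measure[OF compact_group_K[of n]] by simp

lemma space_inductive_limit_borel: "space (inductive_limit_borel K) = carrier G"
  unfolding inductive_limit_borel_def carrier_eq by (simp add: space_measure_of_conv)

lemma topspace_K_subset_carrier: "topspace (K n) \<subseteq> carrier G"
  unfolding carrier_eq by blast

text \<open>Transfers the joint measurability of the action from \<open>G\<close> to
  \<open>K n\<close>, where Haar measure and Fubini are available.\<close>

lemma measurable_inclusion_K:
  assumes "space m = topspace (K n)" "sets m = borel_algebra (K n)"
  shows "(\<lambda>g. g) \<in> measurable m (inductive_limit_borel K)"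
proof (rule measurable_sigma_sets)
  show "sets (inductive_limit_borel K)
      = sigma_sets (carrier G) {U. openin (inductive_limit_topology K) U}"
    unfolding sets_inductive_limit_borel borel_algebra_def topspace_inductive_limit_topology carrier_eq ..
  show "{U. openin (inductive_limit_topology K) U} \<subseteq> Pow (carrier G)"
    by (auto simp: openin_inductive_limit_topology carrier_eq)
  show "(\<lambda>g. g) \<in> space m \<rightarrow> carrier G"
    using assms topspace_K_subset_carrier by auto
  fix U assume "U \<in> {U. openin (inductive_limit_topology K) U}"
  then show "(\<lambda>g. g) -` U \<inter> space m \<in> sets m"
    using assms by (simp add: openin_inductive_limit_topology borel_algebra_openin)
qed

lemma measurable_action_apply:
  assumes "measurable_action G K X T" "g \<in> carrier G"
  shows "T g \<in> measurable X X"
proof -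
  have "(\<lambda>(g, x). T g x) \<circ> Pair g \<in> measurable X X"
    using assms unfolding measurable_action_def
    by (intro measurable_comp[OF measurable_Pair1']) (auto simp: space_inductive_limit_borel)
  then show ?thesis by (simp add: comp_def)
qed

text \<open>
  Averaging over the Haar measure of \<open>K n\<close> replaces \<open>B\<close> by a \<open>K n\<close>-invariant set \<open>C n\<close>; since the
  \<open>K n\<close> increase, the limes inferior of the \<open>C n\<close> is invariant under all of \<open>G\<close>.
\<close>

theorem ex_invariant_version:
  assumes act: "measurable_action G K X T"
    and \<nu>: "prob_space \<nu>" "sets \<nu> = sets X"
    and B: "B \<in> sets X"
    and inv: "\<And>g. g \<in> carrier G \<Longrightarrow> AE x in \<nu>. T g x \<in> B \<longleftrightarrow> x \<in> B"
  shows "\<exists>B'\<in>sets X. (\<forall>g\<in>carrier G. T g ` B' = B') \<and> (AE x in \<nu>. x \<in> B' \<longleftrightarrow> x \<in> B)"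
proof -
  interpret group_action G "space X" T using act unfolding measurable_action_def by blast
  interpret \<nu>: prob_space \<nu> by (rule \<nu>(1))
  have sp\<nu>: "space \<nu> = space X" by (rule sets_eq_imp_space_eq) (rule \<nu>(2))
  obtain m where m: "\<And>n. prob_space (m n)" "\<And>n. space (m n) = topspace (K n)"
      "\<And>n. sets (m n) = borel_algebra (K n)"
      "\<And>n h. h \<in> topspace (K n) \<Longrightarrow> (\<lambda>g. g \<otimes> h) \<in> measurable (m n) (m n)"
      "\<And>n h. h \<in> topspace (K n) \<Longrightarrow> distr (m n) (m n) (\<lambda>g. g \<otimes> h) = m n"
    using ex_haar_measure_K by metis
  have carr: "g \<in> carrier G" if "g \<in> topspace (K n)" for g n
    using that topspace_K_subset_carrier by blast
  have T_closed: "T g x \<in> space X" if "g \<in> topspace (K n)" "x \<in> space X" for g x n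
    using element_image carr that by blast
  have meas: "(\<lambda>p. T (fst p) (snd p)) \<in> measurable (m n \<Otimes>\<^sub>M X) X" for n
  proof -
    have "(\<lambda>p. (fst p, snd p)) \<in> measurable (m n \<Otimes>\<^sub>M X) (inductive_limit_borel K \<Otimes>\<^sub>M X)"
      using measurable_inclusion_K[OF m(2,3)]
      by (intro measurable_Pair measurable_snd measurable_compose[OF measurable_fst])
    from measurable_comp[OF this] act show ?thesis
      unfolding measurable_action_def by (auto simp: comp_def case_prod_unfold)
  qed
  have meas_orbit: "(\<lambda>g. T g x) \<in> measurable (m n) X" if "x \<in> space X" for n x
    using measurable_compose[OF measurable_Pair2'[OF that] meas[of n]] by simp
  \<comment> \<open>Right invariance of Haar measure makes \<open>C n\<close> strictly invariant
    under \<open>K n\<close>, while Fubini makes it agree with \<open>B\<close> up to a null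
    set.\<close>
  define C where "C n = {x \<in> space X. AE g in m n. T g x \<in> B}" for n
  have sets_C: "C n \<in> sets X" for n
  proof -
    interpret m: prob_space "m n" by (rule m(1))
    \<comment> \<open>The sections \<open>?A x\<close> come from one measurable subset of the
      product, so their Haar measure depends measurably on \<open>x\<close>; \<open>C n\<close> is
      where it vanishes.\<close>
    let ?A = "\<lambda>x. {g \<in> space (m n). T g x \<notin> B}"
    have "{p \<in> space (X \<Otimes>\<^sub>M m n). snd p \<in> ?A (fst p)}
        = (\<lambda>p. T (snd p) (fst p)) -` (space X - B) \<inter> space (X \<Otimes>\<^sub>M m n)"
      using T_closed m(2) by (auto simp: space_pair_measure)
    moreover have "(\<lambda>p. T (snd p) (fst p)) \<in> measurable (X \<Otimes>\<^sub>M m n) X"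
      using measurable_compose[OF measurable_pair_swap' meas[of n]] by (simp add: case_prod_unfold)
    ultimately have "{p \<in> space (X \<Otimes>\<^sub>M m n). snd p \<in> ?A (fst p)} \<in> sets (X \<Otimes>\<^sub>M m n)"
      using B by (metis measurable_sets sets.compl_sets)
    then have "(\<lambda>x. emeasure (m n) (?A x)) \<in> borel_measurable X"
      by (intro m.measurable_emeasure) auto
    then have "{x \<in> space X. emeasure (m n) (?A x) = 0} \<in> sets X" by measurable
    moreover have "(AE g in m n. T g x \<in> B) \<longleftrightarrow> emeasure (m n) (?A x) = 0" if "x \<in> space X" for x
    proof (rule AE_iff_measurable)
      have "?A x = (\<lambda>g. T g x) -` (space X - B) \<inter> space (m n)"
        using T_closed m(2) that by auto
      then show "?A x \<in> sets (m n)"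
        using measurable_sets[OF meas_orbit[OF that]] B by (metis sets.compl_sets)
    qed simp
    ultimately show ?thesis unfolding C_def by (simp cong: conj_cong)
  qed
  have AE_C: "AE x in \<nu>. x \<in> C n \<longleftrightarrow> x \<in> B" for n
  proof -
    interpret m: prob_space "m n" by (rule m(1))
    interpret pair_sigma_finite "m n" \<nu> ..
    have [measurable]: "(\<lambda>p. T (fst p) (snd p)) \<in> measurable (m n \<Otimes>\<^sub>M \<nu>) \<nu>"
      using meas[of n] \<nu>(2) by (simp cong: measurable_cong_sets sets_pair_measure_cong)
    have [measurable]: "B \<in> sets \<nu>" using B \<nu>(2) by simp
    \<comment> \<open>The hypothesis gives a null set of points for each \<open>g\<close>; Fubini
      exchanges the quantifiers, so that almost every point is good for almost every
      \<open>g\<close>.\<close>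
    have "AE x in \<nu>. AE g in m n. T g x \<in> B \<longleftrightarrow> x \<in> B"
    proof (subst AE_commute[symmetric])
      show "AE g in m n. AE x in \<nu>. T g x \<in> B \<longleftrightarrow> x \<in> B"
        by (rule AE_I2) (use inv carr m(2) in blast)
    qed measurable
    then show ?thesis
    proof (rule AE_mp, intro AE_I2 impI)
      fix x assume x: "x \<in> space \<nu>" and *: "AE g in m n. T g x \<in> B \<longleftrightarrow> x \<in> B"
      show "x \<in> C n \<longleftrightarrow> x \<in> B"
      proof
        assume "x \<in> B"
        then have "AE g in m n. T g x \<in> B" using * by simp
        then show "x \<in> C n" using x sp\<nu> unfolding C_def by simp
      next
        assume "x \<in> C n"
        then have "AE g in m n. T g x \<in> B" unfolding C_def by simp
        \<comment> \<open>The remaining condition does not involve \<open>g\<close>, and a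
          probability measure does not let a false constant hold almost everywhere.\<close>
        with * have "AE g in m n. x \<in> B" by eventually_elim simp
        then show "x \<in> B" using m.AE_const by simp
      qed
    qed
  qed
  have C_invariant: "T h x \<in> C n \<longleftrightarrow> x \<in> C n" if h: "h \<in> topspace (K n)" and x: "x \<in> space X" for h x n
  proof -
    have Th: "T h x \<in> space X" using element_image[OF carr[OF h] x] by simp
    \<comment> \<open>Acting by \<open>h\<close> first replaces the variable \<open>g\<close> by
      \<open>g \<otimes> h\<close>, a right translation, which leaves \<open>m n\<close>
      unchanged.\<close>
    have "(AE g in m n. T g (T h x) \<in> B) \<longleftrightarrow> (AE g in m n. T (g \<otimes> h) x \<in> B)"
      using composition_rule[OF x] carr h m(2) by (intro AE_cong) auto
    also have "\<dots> \<longleftrightarrow> (AE g in distr (m n) (m n) (\<lambda>g. g \<otimes> h). T g x \<in> B)"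
    proof (rule AE_distr_iff[symmetric])
      have "{g \<in> space (m n). T g x \<in> B} = (\<lambda>g. T g x) -` B \<inter> space (m n)" by auto
      then show "{g \<in> space (m n). T g x \<in> B} \<in> sets (m n)"
        using measurable_sets[OF meas_orbit[OF x] B] by simp
    qed (rule m(4)[OF h])
    also have "\<dots> \<longleftrightarrow> (AE g in m n. T g x \<in> B)" by (simp only: m(5)[OF h])
    finally show ?thesis using x Th unfolding C_def by simp
  qed
  define B' where "B' = {x \<in> space X. \<exists>N. \<forall>n\<ge>N. x \<in> C n}"
  have "B' \<in> sets X" unfolding B'_def using sets_C by measurable
  moreover have "T h ` B' = B'" if h: "h \<in> carrier G" for h
  proof -
    have invar: "T g x \<in> B'" if g: "g \<in> carrier G" and x: "x \<in> B'" for g x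
    proof -
      obtain k where k: "g \<in> topspace (K k)" using g unfolding carrier_eq by blast
      obtain N where N: "\<And>n. n \<ge> N \<Longrightarrow> x \<in> C n" and xX: "x \<in> space X" using x unfolding B'_def by blast
      have "T g x \<in> C n" if "n \<ge> max k N" for n
        using that chain_K_le[of k n] k N[of n] C_invariant[of g n x] xX by auto
      then show ?thesis using element_image[OF g xX] unfolding B'_def by blast
    qed
    show ?thesis
    proof
      show "T h ` B' \<subseteq> B'" using invar h by blast
      show "B' \<subseteq> T h ` B'"
      proof
        fix y assume y: "y \<in> B'"
        then have "y \<in> space X" unfolding B'_def by simp
        then have "T h (T (inv h) y) = y"
          using orbit_sym_aux[of "inv h" y] h by simp
        then show "y \<in> T h ` B'" using invar[of "inv h" y] h y by force
      qed
    qed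
  qed
  moreover have "AE x in \<nu>. x \<in> B' \<longleftrightarrow> x \<in> B"
  proof -
    \<comment> \<open>Countably many null sets combine into one; off it, membership in
      \<open>C n\<close> does not depend on \<open>n\<close>, so the limes inferior agrees with
      \<open>B\<close>.\<close>
    have "AE x in \<nu>. \<forall>n. x \<in> C n \<longleftrightarrow> x \<in> B" using AE_C by (simp add: AE_all_countable)
    then show ?thesis
      by (rule AE_mp) (use sp\<nu> in \<open>auto simp: B'_def intro!: AE_I2\<close>)
  qed
  ultimately show ?thesis by blast
qed

section \<open>Densities between cocycle measures and their invariance\<close>

lemma distr_eq_density_cocycle:
  assumes act: "measurable_action G K X T"
    and \<rho>: "positive_cocycle G K X T \<rho>"
    and \<nu>: "\<nu> \<in> cocycle_measures G X T \<rho>"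
    and g: "g \<in> carrier G"
  shows "distr \<nu> \<nu> (T (inv g)) = density \<nu> (\<lambda>x. ennreal (\<rho> g x))"
    and "\<rho> g \<in> borel_measurable \<nu>"
proof -
  have \<nu>': "prob_space \<nu>" "sets \<nu> = sets X" "absolutely_continuous \<nu> (measure_comp \<nu> (T g))"
      "AE x in \<nu>. RN_deriv \<nu> (measure_comp \<nu> (T g)) x = ennreal (\<rho> g x)"
    using \<nu> g unfolding cocycle_measures_def by auto
  interpret prob_space \<nu> by (rule \<nu>'(1))
  have "(\<lambda>(g, x). \<rho> g x) \<circ> Pair g \<in> borel_measurable X"
    using \<rho> g unfolding positive_cocycle_def
    by (intro measurable_comp[OF measurable_Pair1']) (auto simp: space_inductive_limit_borel)
  then show [measurable]: "\<rho> g \<in> borel_measurable \<nu>"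
    using \<nu>'(2) by (simp add: comp_def cong: measurable_cong_sets)
  note eq = measure_comp_eq_distr(2)[OF act inductively_compact_group_axioms \<nu>'(2) g]
  \<comment> \<open>\<open>RN_deriv\<close> really is a density here, thanks to the absolute
    continuity demanded in \<open>cocycle_measures\<close>.\<close>
  have "measure_comp \<nu> (T g) = density \<nu> (RN_deriv \<nu> (measure_comp \<nu> (T g)))"
    using density_RN_deriv[OF \<nu>'(3)] by (simp add: eq)
  also have "\<dots> = density \<nu> (\<lambda>x. ennreal (\<rho> g x))"
    using \<nu>'(4) by (intro density_cong) auto
  finally show "distr \<nu> \<nu> (T (inv g)) = density \<nu> (\<lambda>x. ennreal (\<rho> g x))" by (simp add: eq)
qed

text \<open>The translate of \<open>density \<nu> f\<close> by \<open>g\<close> has two densities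
  with respect to \<open>\<nu>\<close>: the cocycle times \<open>f\<close>, as this measure obeys
  the cocycle, and the cocycle times \<open>f\<close> composed with \<open>T g\<close>, as
  \<open>\<nu>\<close> does. Uniqueness of densities and positivity of the cocycle give the
  claim.\<close>

lemma density_invariant:
  assumes act: "measurable_action G K X T"
    and \<rho>: "positive_cocycle G K X T \<rho>"
    and \<nu>: "\<nu> \<in> cocycle_measures G X T \<rho>"
    and f: "f \<in> borel_measurable \<nu>" "density \<nu> f \<in> cocycle_measures G X T \<rho>"
    and g: "g \<in> carrier G"
  shows "AE x in \<nu>. f (T g x) = f x"
proof -
  interpret group_action G "space X" T using act unfolding measurable_action_def by blast
  have st: "sets \<nu> = sets X" using \<nu> unfolding cocycle_measures_def by blast
  then have sp: "space \<nu> = space X" by (rule sets_eq_imp_space_eq)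
  note [measurable] = f(1) distr_eq_density_cocycle(2)[OF act \<rho> \<nu> g]
  have [measurable]: "T g \<in> measurable \<nu> \<nu>" "T (inv g) \<in> measurable \<nu> \<nu>"
    using measurable_action_apply[OF act] g st by (simp_all cong: measurable_cong_sets)
  let ?r = "\<lambda>x. ennreal (\<rho> g x)"
  have "density \<nu> (\<lambda>x. f x * ?r x) = distr (density \<nu> f) (density \<nu> f) (T (inv g))"
    using distr_eq_density_cocycle(1)[OF act \<rho> f(2) g] by (simp add: density_density_eq)
  \<comment> \<open>Inserting \<open>T g\<close> after \<open>T (inv g)\<close> brings the density
    into the shape that \<open>density_distr\<close> can pull through the push-forward.\<close>
  also have "\<dots> = distr (density \<nu> (\<lambda>x. f (T g (T (inv g) x)))) \<nu> (T (inv g))"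
  proof (rule distr_cong)
    show "density \<nu> f = density \<nu> (\<lambda>x. f (T g (T (inv g) x)))"
      using orbit_sym_aux[of "inv g"] g sp by (intro density_cong AE_I2) auto
  qed simp_all
  also have "\<dots> = density (distr \<nu> \<nu> (T (inv g))) (\<lambda>x. f (T g x))"
    by (rule density_distr[symmetric]) measurable
  also have "\<dots> = density \<nu> (\<lambda>x. ?r x * f (T g x))"
    by (simp add: distr_eq_density_cocycle(1)[OF act \<rho> \<nu> g] density_density_eq)
  finally have eq: "density \<nu> (\<lambda>x. f x * ?r x) = density \<nu> (\<lambda>x. ?r x * f (T g x))" .
  have "AE x in \<nu>. f x * ?r x = ?r x * f (T g x)"
  \<comment> \<open>Uniqueness needs a finite integral; it equals 1, the mass of a push-forward of
    the probability measure \<open>density \<nu> f\<close>.\<close>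
  proof (rule finite_density_unique[THEN iffD1, OF _ _ _ _ _ eq])
    interpret F: prob_space "density \<nu> f" using f(2) unfolding cocycle_measures_def by blast
    interpret D: prob_space "distr (density \<nu> f) (density \<nu> f) (T (inv g))"
      by (rule F.prob_space_distr) simp
    have "(\<integral>\<^sup>+x. f x * ?r x \<partial>\<nu>) = emeasure (density \<nu> (\<lambda>x. f x * ?r x)) (space \<nu>)"
      by (simp add: emeasure_density cong: nn_integral_cong)
    also have "\<dots> = 1"
      using D.emeasure_space_1 distr_eq_density_cocycle(1)[OF act \<rho> f(2) g]
      by (simp add: density_density_eq)
    finally show "(\<integral>\<^sup>+x. f x * ?r x \<partial>\<nu>) \<noteq> \<infinity>" by simp
  qed auto
  then show ?thesis
  proof (rule AE_mp, intro AE_I2 impI)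
    fix x assume x: "x \<in> space \<nu>" and *: "f x * ?r x = ?r x * f (T g x)"
    \<comment> \<open>Cancellation in \<open>ennreal\<close> needs a factor that is neither zero nor
      infinite.\<close>
    have "\<rho> g x > 0" using \<rho> g x sp unfolding positive_cocycle_def by simp
    with * show "f (T g x) = f x"
      by (simp add: mult.commute[of "f x"] ennreal_mult_cancel_left)
  qed
qed

text \<open>The single level 1 suffices because both measures have mass 1: once the density is at
  least 1 almost everywhere, its integral leaves no room for larger values.\<close>

lemma ergodic_imp_eq:
  assumes act: "measurable_action G K X T"
    and \<rho>: "positive_cocycle G K X T \<rho>"
    and \<nu>: "\<nu> \<in> cocycle_measures G X T \<rho>"
    and erg: "ergodic G X T \<nu>"
    and \<mu>: "\<mu> \<in> cocycle_measures G X T \<rho>"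
    and ac: "absolutely_continuous \<nu> \<mu>"
  shows "\<mu> = \<nu>"
proof -
  interpret group_action G "space X" T using act unfolding measurable_action_def by blast
  interpret \<nu>: prob_space \<nu> using \<nu> unfolding cocycle_measures_def by blast
  interpret \<mu>: prob_space \<mu> using \<mu> unfolding cocycle_measures_def by blast
  have st: "sets \<nu> = sets X" "sets \<mu> = sets X" using \<nu> \<mu> unfolding cocycle_measures_def by auto
  then have sp: "space \<nu> = space X" by (intro sets_eq_imp_space_eq)
  define f where "f = RN_deriv \<nu> \<mu>"
  have [measurable]: "f \<in> borel_measurable \<nu>" unfolding f_def by simp
  have \<mu>_eq: "density \<nu> f = \<mu>"
    unfolding f_def using ac st by (intro \<nu>.density_RN_deriv) auto
  have int: "(\<integral>\<^sup>+x. f x \<partial>\<nu>) = 1"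
  proof -
    have "emeasure (density \<nu> f) (space \<nu>) = 1"
      using \<mu>.emeasure_space_1 sets_eq_imp_space_eq[OF st(2)] by (simp add: \<mu>_eq sp)
    then show ?thesis by (simp add: emeasure_density cong: nn_integral_cong)
  qed
  define B where "B = {x \<in> space \<nu>. f x < 1}"
  have "B \<in> sets \<nu>" unfolding B_def by measurable
  have "AE x in \<nu>. T g x \<in> B \<longleftrightarrow> x \<in> B" if g: "g \<in> carrier G" for g
  proof -
    have "AE x in \<nu>. f (T g x) = f x"
      using density_invariant[OF act \<rho> \<nu>, of f] \<mu> g by (simp add: \<mu>_eq)
    then show ?thesis
      by (rule AE_mp) (use element_image[OF g] sp in \<open>auto simp: B_def intro!: AE_I2\<close>)
  qed
  with ex_invariant_version[OF act \<nu>.prob_space_axioms st(1)] \<open>B \<in> sets \<nu>\<close> st(1)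
  obtain B' where B': "B' \<in> sets X" "\<And>g. g \<in> carrier G \<Longrightarrow> T g ` B' = B'"
      "AE x in \<nu>. x \<in> B' \<longleftrightarrow> x \<in> B" by metis
  have ge: "AE x in \<nu>. 1 \<le> f x"
  proof -
    consider "measure \<nu> B' = 0" | "measure \<nu> (space X - B') = 0"
      using erg B'(1,2) unfolding ergodic_def by blast
    then show ?thesis
    proof cases
      case 1
      then have "AE x in \<nu>. x \<notin> B'" using B'(1) st(1) by (simp add: \<nu>.prob_eq_0)
      with B'(3) AE_space show ?thesis by eventually_elim (auto simp: B_def)
    next
      case 2
      then have "AE x in \<nu>. x \<notin> space X - B'"
        using B'(1) st(1) by (metis \<nu>.prob_eq_0 sets.compl_sets)
      with B'(3) AE_space have less: "AE x in \<nu>. f x < 1"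
        by eventually_elim (auto simp: B_def sp)
      \<comment> \<open>This case is contradictory: the integral of \<open>f\<close> would be
        strictly below that of the constant 1, yet both equal 1.\<close>
      have "\<not> (AE x in \<nu>. 1 \<le> f x)"
      proof
        assume "AE x in \<nu>. 1 \<le> f x"
        with less have "AE x in \<nu>. False" by eventually_elim auto
        then show False by simp
      qed
      then have "(\<integral>\<^sup>+x. f x \<partial>\<nu>) < (\<integral>\<^sup>+x. 1 \<partial>\<nu>)"
        using less int by (intro nn_integral_less) (auto elim: eventually_mono)
      then show ?thesis using int \<nu>.emeasure_space_1 by simp
    qed
  qed
  have "AE x in \<nu>. f x \<le> 1"
  proof (rule ccontr)
    assume "\<not> ?thesis"
    then have "(\<integral>\<^sup>+x. 1 \<partial>\<nu>) < (\<integral>\<^sup>+x. f x \<partial>\<nu>)"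
      using ge \<nu>.emeasure_space_1 by (intro nn_integral_less) auto
    then show False using int \<nu>.emeasure_space_1 by simp
  qed
  with ge have "AE x in \<nu>. f x = 1" by eventually_elim simp
  then have "density \<nu> f = density \<nu> (\<lambda>_. 1)" by (intro density_cong) auto
  then show ?thesis by (simp add: \<mu>_eq density_1)
qed

end

text \<open>Both components enter with positive weight, hence are absolutely continuous with respect
  to \<open>\<nu>\<close>, and \<open>ergodic_imp_eq\<close> applies to each of them.\<close>

theorem proposition2:
  fixes G :: "('g, 'r) monoid_scheme" and K :: "nat \<Rightarrow> 'g topology"
    and X :: "'x measure" and T :: "'g \<Rightarrow> 'x \<Rightarrow> 'x" and \<rho> :: "'g \<Rightarrow> 'x \<Rightarrow> real"
    and \<nu> :: "'x measure"
  assumes "inductively_compact_group G K"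
    and "standard_borel_space X"
    and "measurable_action G K X T"
    and "positive_cocycle G K X T \<rho>"
    and "\<nu> \<in> cocycle_measures G X T \<rho>"
    and "ergodic G X T \<nu>"
  shows "indecomposable_in (cocycle_measures G X T \<rho>) \<nu>"
  unfolding indecomposable_in_def
proof (intro ballI impI)
  interpret inductively_compact_group G K by fact
  fix \<alpha> :: real and \<nu>1 \<nu>2
  assume \<alpha>: "\<alpha> \<in> {0<..<1}"
    and \<nu>12: "\<nu>1 \<in> cocycle_measures G X T \<rho>" "\<nu>2 \<in> cocycle_measures G X T \<rho>"
    and dec: "\<forall>A\<in>sets \<nu>. measure \<nu> A = \<alpha> * measure \<nu>1 A + (1 - \<alpha>) * measure \<nu>2 A"
  have ac: "absolutely_continuous \<nu> \<mu>"
    if \<mu>: "\<mu> \<in> cocycle_measures G X T \<rho>" and c: "c > 0"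
      and le: "\<And>A. A \<in> sets \<nu> \<Longrightarrow> c * measure \<mu> A \<le> measure \<nu> A" for \<mu> and c :: real
    unfolding absolutely_continuous_def
  proof
    fix A assume A: "A \<in> null_sets \<nu>"
    interpret prob_space \<mu> using \<mu> unfolding cocycle_measures_def by blast
    have "sets \<mu> = sets \<nu>" using assms(5) \<mu> unfolding cocycle_measures_def by auto
    moreover have "c * measure \<mu> A \<le> 0"
      using le[of A] A by (simp add: null_sets_def measure_def)
    then have "measure \<mu> A = 0" using c by (simp add: mult_le_0_iff measure_le_0_iff)
    ultimately show "A \<in> null_sets \<mu>" using A by (auto simp: null_sets_def emeasure_eq_measure)
  qed
  \<comment> \<open>Dropping the other, nonnegative summand of \<open>dec\<close> gives the bound
    that \<open>ac\<close> asks for, with the weight as constant.\<close>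
  have "\<nu>1 = \<nu>"
    by (rule ergodic_imp_eq[OF assms(3-6) \<nu>12(1) ac[OF \<nu>12(1), of \<alpha>]]) (use \<alpha> dec in auto)
  moreover have "\<nu>2 = \<nu>"
    by (rule ergodic_imp_eq[OF assms(3-6) \<nu>12(2) ac[OF \<nu>12(2), of "1 - \<alpha>"]]) (use \<alpha> dec in auto)
  ultimately show "\<nu> = \<nu>1 \<and> \<nu> = \<nu>2" by simp
qed

end
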